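(* Let $k\ge2$, $N\in\{1,2,\dots\}$, $l\in\{1,2,\dots\}$ and $M=Nl$. The spider-web graph $\vec{SW}_{k,N,Nl}$ is weakly isomorphic (isomorphic as oriented graphs ignoring labels) to the oriented Cayley graph of $\bigl(\bigoplus_{i=1}^N\mathbb Z/k\mathbb Z\bigr)\rtimes\mathbb Z/Nl\mathbb Z$, where $\mathbb Z/Nl\mathbb Z$ acts on $\bigoplus_{i=1}^N\mathbb Z/k\mathbb Z$ by cyclic shift of coordinates, with respect to the generating set $\{c^ib\}_{i=0}^{k-1}$, where $b$ is a generator of $\mathbb Z/Nl\mathbb Z$ and $c$ a generator of (one coordinate copy of) $\mathbb Z/k\mathbb Z$. In particular, writing $\mathcal L_{k,N}=\mathbb Z/k\mathbb Z\wr\mathbb Z/N\mathbb Z$, and $\simeq$ for weak isomorphism: if $N$ and $l$ are coprime, $SW_{k,N,Nl}\simeq\mathrm{Cay}\bigl(\mathcal L_{k,N}\times\mathbb Z/l\mathbb Z,\{(c^rb,1)\}_{r=0}^{k-1}\bigr)$; for every $M\ge1$, $SW_{k,M,M}\simeq\mathrm{Cay}\bigl(\mathcal L_{k,M},\{c^rb\}_{r=0}^{k-1}\bigr)$; for every $M\ge1$, $SW_{k,1,M}\simeq\mathrm{Cay}\bigl(\mathbb Z/k\mathbb Z\times\mathbb Z/M\mathbb Z,\{(r,1)\}_{r=0}^{k-1}\bigr)$; and $SW_{k,1,\infty}\simeq\mathrm{Cay}\bigl(\mathbb Z/k\mathbb Z\times\mathbb Z,\{(r,1)\}_{r=0}^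{k-1}\bigr)$.
   Context: Loops and multiple edges allowed. The oriented spider-web graph $\vec{SW}_{k,N,M}$ ($N\ge0$, $M\in\{1,2,\dots\}\cup\{\infty\}$) has vertex set $\{0,\dots,k-1\}^N\times\mathbb Z/M\mathbb Z$ (with $\mathbb Z/\infty\mathbb Z:=\mathbb Z$) and, for each vertex $(x_1\dots x_N,i)$ and each $y\in\{0,\dots,k-1\}$, one edge from $(x_1\dots x_N,i)$ to $(x_2\dots x_Ny,i+1)$; $SW_{k,N,M}$ is its underlying non-oriented graph. For a group $G$ and finite generating set $S$, the oriented Cayley graph has vertex set $G$ and an edge $g\to gs$ for each $s\in S$; $\mathrm{Cay}(G,S)$ is its underlying non-oriented graph. In $\mathcal L_{k,N}=\mathbb Z/k\mathbb Z\wr\mathbb Z/N\mathbb Z=(\bigoplus_{\mathbb Z/N\mathbb Z}\mathbb Z/k\mathbb Z)\rtimes\mathbb Z/N\mathbb Z$, $b$ generates $\mathbb Z/N\mathbb Z$ acting by shift and $c$ generates the copy of $\mathbb Z/k\mathbb Z$ at coordinate $0$. *)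

theory Defs
  imports
    "HOL-Algebra.Product_Groups"
    "HOL-Algebra.Elementary_Groups"
    "HOL-Algebra.Generated_Groups"
    "HOL-Library.Extended_Nat"
    "Graph_Theory.Digraph_Isomorphism"
begin

section \<open>Graphs with loops and multiple edges\<close>

text \<open>Oriented graphs are the multi-digraphs \<^typ>\<open>('v, 'e) pre_digraph\<close>; weak isomorphism of
  oriented graphs is \<^const>\<open>digraph_iso\<close>, since no labels are part of the structure.
  A non-oriented graph assigns to each edge its set of endpoints, which is a singleton for
  a loop.\<close>

record ('v, 'e) multigraph =
  mverts :: "'v set"
  medges :: "'e set"
  mends :: "'e \<Rightarrow> 'v set"

definition underlying :: "('v, 'e) pre_digraph \<Rightarrow> ('v, 'e) multigraph" where
  "underlying D = \<lparr>mverts = verts D, medges = arcs D, mends = (\<lambda>e. {tail D e, head D e})\<rparr>"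

definition multigraph_iso :: "('v, 'e) multigraph \<Rightarrow> ('w, 'f) multigraph \<Rightarrow> bool" where
  "multigraph_iso X Y \<longleftrightarrow>
     (\<exists>\<phi> \<psi>. bij_betw \<phi> (mverts X) (mverts Y) \<and> bij_betw \<psi> (medges X) (medges Y) \<and>
            (\<forall>e\<in>medges X. mends Y (\<psi> e) = \<phi> ` mends X e))"


section \<open>Spider-web graphs\<close>

definition cyc :: "enat \<Rightarrow> int monoid" where
  "cyc M = (case M of enat m \<Rightarrow> integer_mod_group m | \<infinity> \<Rightarrow> integer_group)"

text \<open>The class of 1; reduced because \<^term>\<open>carrier (integer_mod_group m)\<close> is
  \<^term>\<open>{0..<int m}\<close>, so for \<open>m = 1\<close> it is 0.\<close>

definition cyc_one :: "enat \<Rightarrow> int" where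
  "cyc_one M = (case M of enat m \<Rightarrow> 1 mod int m | \<infinity> \<Rightarrow> 1)"

text \<open>The arc \<open>((x, i), y)\<close> starts at \<open>(x, i)\<close>.  Dropping the first letter after appending \<open>y\<close>
  (rather than before) also gives the right target for \<open>N = 0\<close>, where \<open>x\<close> is empty.\<close>

definition spider_web ::
  "nat \<Rightarrow> nat \<Rightarrow> enat \<Rightarrow> (nat list \<times> int, (nat list \<times> int) \<times> nat) pre_digraph" where
  "spider_web k N M =
    \<lparr>verts = {x. length x = N \<and> set x \<subseteq> {..<k}} \<times> carrier (cyc M),
     arcs = ({x. length x = N \<and> set x \<subseteq> {..<k}} \<times> carrier (cyc M)) \<times> {..<k},
     tail = fst,
     head = (\<lambda>((x, i), y). (tl (x @ [y]), i \<otimes>\<^bsub>cyc M\<^esub> cyc_one M))\<rparr>"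


section \<open>Cayley graphs\<close>

definition cayley :: "('a, 'm) monoid_scheme \<Rightarrow> 'a set \<Rightarrow> ('a, 'a \<times> 'a) pre_digraph" where
  "cayley G S =
    \<lparr>verts = carrier G, arcs = carrier G \<times> S, tail = fst, head = (\<lambda>(g, s). g \<otimes>\<^bsub>G\<^esub> s)\<rparr>"


section \<open>Semidirect and wreath products\<close>

definition semidirect ::
  "('a, 'm) monoid_scheme \<Rightarrow> ('b, 'n) monoid_scheme \<Rightarrow> ('b \<Rightarrow> 'a \<Rightarrow> 'a) \<Rightarrow> ('a \<times> 'b) monoid" where
  "semidirect H K \<alpha> =
    \<lparr>carrier = carrier H \<times> carrier K,
     monoid.mult = (\<lambda>(h, x) (h', x'). (h \<otimes>\<^bsub>H\<^esub> \<alpha> x h', x \<otimes>\<^bsub>K\<^esub> x')),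
     one = (\<one>\<^bsub>H\<^esub>, \<one>\<^bsub>K\<^esub>)\<rparr>"

text \<open>The copies, inside a semidirect product \<open>(\<Oplus>\<^bsub>I\<^esub> A) \<rtimes> K\<close>, of the complement \<open>K\<close> and of the
  summand \<open>A\<close> at coordinate \<open>p\<close>.\<close>

definition complement_copy ::
  "'i set \<Rightarrow> ('a, 'm) monoid_scheme \<Rightarrow> ('b, 'n) monoid_scheme \<Rightarrow> (('i \<Rightarrow> 'a) \<times> 'b) set" where
  "complement_copy I A K = {\<one>\<^bsub>sum_group I (\<lambda>_. A)\<^esub>} \<times> carrier K"

definition coordinate_copy ::
  "'i set \<Rightarrow> ('a, 'm) monoid_scheme \<Rightarrow> ('b, 'n) monoid_scheme \<Rightarrow> 'i \<Rightarrow> (('i \<Rightarrow> 'a) \<times> 'b) set" where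
  "coordinate_copy I A K p =
     {f \<in> carrier (sum_group I (\<lambda>_. A)). \<forall>i\<in>I. i \<noteq> p \<longrightarrow> f i = \<one>\<^bsub>A\<^esub>} \<times> {\<one>\<^bsub>K\<^esub>}"

definition wreath ::
  "('a, 'm) monoid_scheme \<Rightarrow> ('b, 'n) monoid_scheme \<Rightarrow> (('b \<Rightarrow> 'a) \<times> 'b) monoid" where
  "wreath A B =
     semidirect (sum_group (carrier B) (\<lambda>_. A)) B
       (\<lambda>x f. \<lambda>i\<in>carrier B. f (inv\<^bsub>B\<^esub> x \<otimes>\<^bsub>B\<^esub> i))"

definition lamplighter :: "nat \<Rightarrow> nat \<Rightarrow> ((int \<Rightarrow> int) \<times> int) monoid" where
  "lamplighter k N = wreath (integer_mod_group k) (integer_mod_group N)"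

text \<open>The group \<open>(\<Oplus>\<^bsub>N\<^esub> \<int>/k) \<rtimes> \<int>/m\<close>, for \<open>m\<close> a multiple of \<open>N\<close>, with \<open>j\<close> acting as the
  \<open>j\<close>-fold cyclic shift.  The \<open>N\<close> coordinates are numbered from 0.\<close>

definition shift_extension :: "nat \<Rightarrow> nat \<Rightarrow> nat \<Rightarrow> ((int \<Rightarrow> int) \<times> int) monoid" where
  "shift_extension k N m =
     semidirect (sum_group {0..<int N} (\<lambda>_. integer_mod_group k)) (integer_mod_group m)
       (\<lambda>j f. \<lambda>i\<in>{0..<int N}. f ((i - j) mod int N))"

text \<open>The set \<open>{c\<^sup>r b | 0 \<le> r < k}\<close>.\<close>

definition switch_walk :: "('a, 'm) monoid_scheme \<Rightarrow> nat \<Rightarrow> 'a \<Rightarrow> 'a \<Rightarrow> 'a set" where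
  "switch_walk G k c b = (\<lambda>r. (c [^]\<^bsub>G\<^esub> r) \<otimes>\<^bsub>G\<^esub> b) ` {..<k}"

end

theory Submission
  imports Defs "HOL-Algebra.Multiplicative_Group" "HOL-Number_Theory.Cong"
begin

text \<open>A step in the Cayley graph moves the cursor by the generator \<open>\<beta>\<close> and changes the
  lamp under the cursor to an arbitrary value. As \<open>\<beta>\<close> is a unit modulo \<open>N\<close>, any \<open>N\<close> consecutive
  steps visit each of the \<open>N\<close> lamps once. Listing the lamps in the order in which they are going
  to be visited turns a configuration into a word of length \<open>N\<close>, and one step deletes the first
  letter of this word and appends the new value. Since the spider-web graph is connected, such an
  isomorphism also shows that the steps generate the group.\<close>

section \<open>Words over an alphabet of \<open>k\<close> letters\<close>

abbreviation words :: "nat \<Rightarrow> nat \<Rightarrow> nat list set" where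
  "words k N \<equiv> {x. length x = N \<and> set x \<subseteq> {..<k}}"

lemma words_step: "x \<in> words k N \<Longrightarrow> y < k \<Longrightarrow> tl (x @ [y]) \<in> words k N"
  by (cases x) auto

lemma card_words: "card (words k N) = k ^ N"
  using card_lists_length_eq[of "{..<k}" N] by (simp add: conj_commute)

section \<open>Connectedness of spider-web graphs\<close>

text \<open>Period 0 encodes the infinite cyclic group, where \<open>j mod 0 = j\<close>.\<close>

definition period :: "enat \<Rightarrow> int" where
  "period M = (case M of enat m \<Rightarrow> int m | \<infinity> \<Rightarrow> 0)"

lemma period_simps [simp]: "period (enat m) = int m" "period \<infinity> = 0"
  by (simp_all add: period_def)

lemma mult_cyc: "i \<otimes>\<^bsub>cyc M\<^esub> j = (i + j) mod period M"
  by (cases M) (simp_all add: cyc_def)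

lemma cyc_one_eq: "cyc_one M = 1 mod period M"
  by (cases M) (simp_all add: cyc_one_def)

text \<open>Writing levels as \<open>j mod period M\<close> lets every integer \<open>j\<close>
  stand for a level, so that finite and infinite \<open>M\<close> are treated together.\<close>

lemma carrier_cyc: "carrier (cyc M) = range (\<lambda>j. j mod period M)"
proof (cases M)
  case (enat m)
  have "j \<in> range (\<lambda>j. j mod int m)" if "j \<in> {0..<int m}" for j
    using that by (intro image_eqI[of _ _ j]) auto
  then show ?thesis
    by (auto simp: enat cyc_def carrier_integer_mod_group)
qed (simp add: cyc_def)

lemma cyc_step: "(j mod period M) \<otimes>\<^bsub>cyc M\<^esub> cyc_one M = (j + 1) mod period M"
  by (simp add: mult_cyc cyc_one_eq mod_add_eq)

text \<open>Reading \<open>N\<close> letters erases the word one started from, so any two words at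
  the same level lead to a common vertex. A single step joins consecutive levels. Hence a set that
  no arc enters or leaves is empty or contains every vertex.\<close>

lemma spider_web_connected:
  assumes "k > 0"
    and closed: "\<And>e. e \<in> arcs (spider_web k N M) \<Longrightarrow>
      tail (spider_web k N M) e \<in> A \<longleftrightarrow> head (spider_web k N M) e \<in> A"
    and "v \<in> verts (spider_web k N M)" "v \<in> A" "w \<in> verts (spider_web k N M)"
  shows "w \<in> A"
proof -
  let ?q = "period M"
  have step: "(x, j mod ?q) \<in> A \<longleftrightarrow> (tl (x @ [y]), (j + 1) mod ?q) \<in> A"
    if "x \<in> words k N" "y < k" for x y j
    using closed[of "((x, j mod ?q), y)"] that
    by (simp add: spider_web_def carrier_cyc cyc_step)
  \<comment> \<open>After the letters of \<open>z\<close> have been read, the current word consists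
    of the last \<open>N\<close> letters of \<open>x @ z\<close>.\<close>
  have walk: "(x, j mod ?q) \<in> A \<longleftrightarrow> (drop (length z) (x @ z), (j + int (length z)) mod ?q) \<in> A"
    if "x \<in> words k N" "set z \<subseteq> {..<k}" for x z j
    using that
  proof (induction z arbitrary: x j)
    case (Cons y z)
    have eq: "drop (length z) (tl (x @ [y]) @ z) = drop (length (y # z)) (x @ y # z)"
      by (cases x) auto
    have "(x, j mod ?q) \<in> A \<longleftrightarrow> (tl (x @ [y]), (j + 1) mod ?q) \<in> A"
      using step Cons.prems by simp
    also have "\<dots> \<longleftrightarrow> (drop (length z) (tl (x @ [y]) @ z), (j + 1 + int (length z)) mod ?q) \<in> A"
      using Cons.prems words_step by (intro Cons.IH) auto
    finally show ?case
      unfolding eq by (simp add: algebra_simps)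
  qed simp
  \<comment> \<open>Reading the letters of \<open>x'\<close> leads from \<open>x\<close> as well as
    from \<open>x'\<close> to the word \<open>x'\<close> at level \<open>j + N\<close>.\<close>
  have swap: "(x, j mod ?q) \<in> A \<longleftrightarrow> (x', j mod ?q) \<in> A"
    if "x \<in> words k N" "x' \<in> words k N" for x x' j
    using walk[of x x' j] walk[of x' x' j] that by simp
  \<comment> \<open>The letter 0, available because \<open>k > 0\<close>, gives a step to the next
    level, where \<open>swap\<close> restores the word \<open>x\<close>.\<close>
  have succ: "(x, j mod ?q) \<in> A \<longleftrightarrow> (x, (j + 1) mod ?q) \<in> A" if "x \<in> words k N" for x j
    using step[OF that assms(1)] swap[OF that words_step[OF that assms(1)]] by blast
  have base: "(x, j mod ?q) \<in> A \<longleftrightarrow> (x, 0 mod ?q) \<in> A" if "x \<in> words k N" for x j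
  proof (induction j rule: int_induct[where k = 0])
    case (step1 i)
    then show ?case using succ[OF that] by metis
  next
    case (step2 i)
    then show ?case using succ[OF that, of "i - 1"] by simp
  qed simp
  obtain x j where v: "v = (x, j mod ?q)" "x \<in> words k N"
    using assms(3) by (auto simp: spider_web_def carrier_cyc)
  obtain x' j' where w: "w = (x', j' mod ?q)" "x' \<in> words k N"
    using assms(5) by (auto simp: spider_web_def carrier_cyc)
  show ?thesis
    using assms(4) base[OF v(2), of j] base[OF w(2), of j'] swap[OF v(2) w(2), of 0] v w by simp
qed

section \<open>A criterion for a Cayley graph to be a spider-web graph\<close>

text \<open>An oriented isomorphism carries tails to tails and heads to heads, hence endpoint sets
  to endpoint sets, so its vertex and arc bijections can be reused.\<close>

lemma digraph_iso_imp_multigraph_iso: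
  assumes "digraph_iso D E"
  shows "multigraph_iso (underlying D) (underlying E)"
proof -
  obtain f where f: "pre_digraph.digraph_isomorphism D f" and E: "E = app_iso f D"
    using assms by (auto simp: digraph_iso_def)
  show ?thesis
    unfolding multigraph_iso_def E
    using f by (intro exI[of _ "iso_verts f"] exI[of _ "iso_arcs f"])
      (auto simp: underlying_def app_iso_def pre_digraph.digraph_isomorphism_def bij_betw_def)
qed

text \<open>Weak isomorphism ignores labels, so letters may be matched with generators differently
  at each word; therefore \<open>\<rho>\<close> takes \<open>x\<close> as an argument. The arc map
  is bijective because \<open>\<Phi>\<close> and each \<open>\<rho> x\<close> are. Generation
  follows from connectedness: the vertices sent into the generated subgroup form a set that no arc
  enters or leaves.\<close>

lemma spider_web_cayley:
  fixes G (structure)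
  assumes "group G" and S: "S \<subseteq> carrier G" and "k > 0"
    and bij: "bij_betw (\<lambda>(x, i). \<Phi> x i) (words k N \<times> carrier (cyc M)) (carrier G)"
    and step: "\<And>x i y. x \<in> words k N \<Longrightarrow> i \<in> carrier (cyc M) \<Longrightarrow> y < k \<Longrightarrow>
      \<Phi> (tl (x @ [y])) (i \<otimes>\<^bsub>cyc M\<^esub> cyc_one M) = \<Phi> x i \<otimes> \<rho> x y"
    and \<rho>: "\<And>x. x \<in> words k N \<Longrightarrow> bij_betw (\<rho> x) {..<k} S"
  shows "generate G S = carrier G \<and> digraph_iso (spider_web k N M) (cayley G S)"
proof -
  interpret group G by fact
  let ?W = "spider_web k N M"
  define f where "f = (\<lambda>(x, i). \<Phi> x i)"
  define h where "h = (\<lambda>((x, i), y). (\<Phi> x i, \<rho> x y))"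
  have verts: "verts ?W = words k N \<times> carrier (cyc M)"
    and arcs: "arcs ?W = (words k N \<times> carrier (cyc M)) \<times> {..<k}"
    by (simp_all add: spider_web_def)
  have f: "bij_betw f (verts ?W) (carrier G)"
    using bij by (simp add: f_def verts)
  have head_in: "head ?W e \<in> verts ?W" if e: "e \<in> arcs ?W" for e
  proof -
    obtain x j y where [simp]: "e = ((x, j mod period M), y)" and "x \<in> words k N" "y < k"
      using e by (auto simp: arcs carrier_cyc)
    then show ?thesis
      using words_step by (auto simp: verts spider_web_def cyc_step carrier_cyc)
  qed
  have tail_in: "tail ?W e \<in> verts ?W" if "e \<in> arcs ?W" for e
    using that by (auto simp: verts arcs spider_web_def)
  have f_head: "f (head ?W ((x, i), y)) = \<Phi> x i \<otimes> \<rho> x y"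
    if "((x, i), y) \<in> arcs ?W" for x i y
    using that step by (auto simp: arcs f_def spider_web_def)
  have h: "bij_betw h (arcs ?W) (carrier G \<times> S)"
  proof (rule bij_betw_imageI)
    show "inj_on h (arcs ?W)"
    proof (rule inj_onI)
      fix e e' assume *: "e \<in> arcs ?W" "e' \<in> arcs ?W" "h e = h e'"
      obtain x i y x' i' y' where e: "e = ((x, i), y)" "e' = ((x', i'), y')"
        by (metis prod.exhaust)
      have "f (x, i) = f (x', i')" "(x, i) \<in> verts ?W" "(x', i') \<in> verts ?W"
        using * by (auto simp: e h_def f_def arcs verts)
      then have eq: "(x, i) = (x', i')"
        using f by (metis bij_betw_inv_into_left)
      moreover have "y = y'"
        using * eq bij_betw_imp_inj_on[OF \<rho>, of x] by (simp add: e h_def arcs inj_on_def)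
      ultimately show "e = e'" by (simp add: e)
    qed
    have "h ((x, i), y) \<in> carrier G \<times> S" if "((x, i), y) \<in> arcs ?W" for x i y
      using that bij_betw_apply[OF f, of "(x, i)"] bij_betw_apply[OF \<rho>, of x y]
      by (simp add: h_def arcs verts f_def)
    then have "h ` arcs ?W \<subseteq> carrier G \<times> S" by (metis image_subsetI prod.exhaust)
    moreover have "(g, s) \<in> h ` arcs ?W" if "g \<in> carrier G" "s \<in> S" for g s
    proof -
      have "g \<in> f ` verts ?W"
        using bij_betw_imp_surj_on[OF f] that(1) by simp
      then obtain v where "v \<in> verts ?W" "f v = g" by blast
      then obtain x i where xi: "(x, i) \<in> verts ?W" "g = \<Phi> x i"
        by (cases v) (auto simp: f_def)
      then have "s \<in> \<rho> x ` {..<k}"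
        using bij_betw_imp_surj_on[OF \<rho>, of x] that(2) by (simp add: verts)
      then obtain y where "y \<in> {..<k}" "s = \<rho> x y" by blast
      with xi show ?thesis
        by (intro image_eqI[of _ _ "((x, i), y)"]) (auto simp: h_def arcs verts)
    qed
    ultimately show "h ` arcs ?W = carrier G \<times> S" by auto
  qed
  have "digraph_iso ?W (cayley G S)"
    unfolding digraph_iso_def
  proof (intro exI conjI)
    \<comment> \<open>The graph \<open>app_iso ?F ?W\<close> takes its head and tail functions from
      the fields of \<open>?F\<close>. Filling in those of the Cayley graph makes the image equal to
      it, also outside the set of arcs.\<close>
    let ?F = "\<lparr>iso_verts = f, iso_arcs = h, iso_head = head (cayley G S),
      iso_tail = tail (cayley G S)\<rparr>"
    show "cayley G S = app_iso ?F ?W"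
      using f h by (simp add: app_iso_def cayley_def bij_betw_def)
    have "wf_digraph ?W"
      using head_in tail_in by unfold_locales
    moreover have "f (tail ?W a) = tail (cayley G S) (h a)" if "a \<in> arcs ?W" for a
      using that by (auto simp: f_def h_def cayley_def spider_web_def)
    moreover have "f (head ?W a) = head (cayley G S) (h a)" if "a \<in> arcs ?W" for a
      using that f_head by (cases a) (auto simp: h_def cayley_def)
    ultimately show "pre_digraph.digraph_isomorphism ?W ?F"
      using f h by (simp add: pre_digraph.digraph_isomorphism_def bij_betw_def)
  qed
  moreover have "carrier G \<subseteq> generate G S"
  proof
    fix g assume g: "g \<in> carrier G"
    interpret H: subgroup "generate G S" G
      using S by (rule generate_is_subgroup)
    let ?A = "f -` generate G S"
    have "f (tail ?W e) \<in> generate G S \<longleftrightarrow> f (head ?W e) \<in> generate G S"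
      if e: "e \<in> arcs ?W" for e
    proof -
      obtain x i y where xy [simp]: "e = ((x, i), y)" by (metis prod.exhaust)
      have v: "(x, i) \<in> verts ?W" "y \<in> {..<k}" and x: "x \<in> words k N"
        using e by (auto simp: arcs verts)
      have s: "\<rho> x y \<in> generate G S"
        using bij_betw_apply[OF \<rho>[OF x] v(2)] by (rule generate.incl)
      have g: "\<Phi> x i \<in> carrier G"
        using bij_betw_apply[OF f v(1)] by (simp add: f_def)
      \<comment> \<open>Cancelling the generator carries membership in the subgroup backwards along
        the arc.\<close>
      have "\<Phi> x i \<otimes> \<rho> x y \<otimes> inv \<rho> x y = \<Phi> x i"
        using g H.mem_carrier[OF s] by (simp add: m_assoc)
      then have "\<Phi> x i \<in> generate G S \<longleftrightarrow> \<Phi> x i \<otimes> \<rho> x y \<in> generate G S"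
        using s H.m_closed H.m_inv_closed by metis
      moreover have "f (tail ?W e) = \<Phi> x i"
        by (simp add: spider_web_def f_def)
      moreover have "f (head ?W e) = \<Phi> x i \<otimes> \<rho> x y"
        using f_head e by simp
      ultimately show ?thesis by simp
    qed
    then have A: "tail ?W e \<in> ?A \<longleftrightarrow> head ?W e \<in> ?A" if "e \<in> arcs ?W" for e
      using that by simp
    have "\<one> \<in> f ` verts ?W" "g \<in> f ` verts ?W"
      using bij_betw_imp_surj_on[OF f] g by simp_all
    then obtain v w where "v \<in> verts ?W" "f v = \<one>" "w \<in> verts ?W" "f w = g"
      by (elim imageE) simp
    then show "g \<in> generate G S"
      using spider_web_connected[of k N M ?A v w, OF assms(3) A] by simp
  qed
  ultimately show ?thesis
    using generate_incl[OF S] by blast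
qed

text \<open>Replacing the value \<open>a\<close> by the letter \<open>y\<close> means adding
  \<open>y - a\<close> modulo \<open>k\<close>; adding \<open>a\<close> back recovers the letter.
  This matches letters with generators at a word whose first letter is \<open>a\<close>.\<close>

lemma bij_betw_diff_mod:
  assumes "k > 0"
  shows "bij_betw (\<lambda>y. (int y - a) mod int k) {..<k} {0..<int k}"
proof (rule bij_betw_byWitness[where f' = "\<lambda>r. nat ((r + a) mod int k)"])
  show "\<forall>y\<in>{..<k}. nat (((int y - a) mod int k + a) mod int k) = y"
    by (simp add: mod_add_left_eq)
  show "\<forall>r\<in>{0..<int k}. (int (nat ((r + a) mod int k)) - a) mod int k = r"
    using assms by (simp add: mod_diff_left_eq)
  show "(\<lambda>y. (int y - a) mod int k) ` {..<k} \<subseteq> {0..<int k}"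
    using assms by auto
  show "(\<lambda>r. nat ((r + a) mod int k)) ` {0..<int k} \<subseteq> {..<k}"
    using assms by (auto simp: nat_less_iff)
qed

section \<open>Words of length one\<close>

text \<open>A word of length one is a single residue, and a step replaces it by an arbitrary one
  while the level grows by 1. The generator used is therefore the difference of the two
  letters.\<close>

lemma spider_web_length_one:
  assumes "k > 0"
  shows "generate (integer_mod_group k \<times>\<times> cyc M) ({0..<int k} \<times> {cyc_one M})
      = carrier (integer_mod_group k \<times>\<times> cyc M) \<and>
    digraph_iso (spider_web k 1 M)
      (cayley (integer_mod_group k \<times>\<times> cyc M) ({0..<int k} \<times> {cyc_one M}))"
proof (rule spider_web_cayley[where \<Phi> = "\<lambda>x i. (int (hd x), i)"
      and \<rho> = "\<lambda>x y. ((int y - int (hd x)) mod int k, cyc_one M)"])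
  have "group (cyc M)" by (cases M) (simp_all add: cyc_def)
  then show "group (integer_mod_group k \<times>\<times> cyc M)"
    by (simp add: DirProd_group)
  show "{0..<int k} \<times> {cyc_one M} \<subseteq> carrier (integer_mod_group k \<times>\<times> cyc M)"
    using assms by (auto simp: carrier_integer_mod_group cyc_one_eq carrier_cyc)
  show "bij_betw (\<lambda>(x, i). (int (hd x), i)) (words k 1 \<times> carrier (cyc M))
      (carrier (integer_mod_group k \<times>\<times> cyc M))"
    using assms
    by (intro bij_betw_byWitness[where f' = "\<lambda>(r, i). ([nat r], i)"])
      (auto simp: carrier_integer_mod_group length_Suc_conv)
  show "bij_betw (\<lambda>y. ((int y - int (hd x)) mod int k, cyc_one M)) {..<k}
      ({0..<int k} \<times> {cyc_one M})" for x
  proof -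
    have "bij_betw (\<lambda>r. (r, cyc_one M)) {0..<int k} ({0..<int k} \<times> {cyc_one M})"
      by (auto simp: bij_betw_def inj_on_def)
    from bij_betw_trans[OF bij_betw_diff_mod[OF assms] this] show ?thesis
      by (simp add: comp_def)
  qed
next
  fix x i y assume "x \<in> words k 1" "i \<in> carrier (cyc M)" "y < k"
  then show "(int (hd (tl (x @ [y]))), i \<otimes>\<^bsub>cyc M\<^esub> cyc_one M) =
      (int (hd x), i) \<otimes>\<^bsub>integer_mod_group k \<times>\<times> cyc M\<^esub> ((int y - int (hd x)) mod int k, cyc_one M)"
    by (cases x) (simp_all add: mod_add_right_eq)
qed (use assms in simp)

section \<open>Cyclic shift extensions\<close>

lemma inj_on_case_prodI:
  assumes "\<And>x i x' i'. x \<in> A \<Longrightarrow> i \<in> B \<Longrightarrow> x' \<in> A \<Longrightarrow> i' \<in> B \<Longrightarrow> f x i = f x' i' \<Longrightarrow>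
    x = x' \<and> i = i'"
  shows "inj_on (\<lambda>(x, i). f x i) (A \<times> B)"
  using assms by (auto intro!: inj_onI)

lemma carrier_sum_group_finite:
  assumes "finite I" "group A"
  shows "carrier (sum_group I (\<lambda>_. A)) = (\<Pi>\<^sub>E i\<in>I. carrier A)"
  using assms by (simp add: carrier_sum_group)

text \<open>Common form of the shift extension, where \<open>m = N * l\<close>, and of the
  lamplighter group, where \<open>m = N\<close>. The second component is a cursor modulo
  \<open>m\<close> that acts through its residue modulo \<open>N\<close>. The group axioms are
  derived from the explicit product, so both groups are handled by one argument.\<close>

locale shift_group =
  fixes G :: "((int \<Rightarrow> int) \<times> int) monoid" (structure) and k N m :: nat
  assumes k_pos: "k > 0" and N_pos: "N > 0" and m_pos: "m > 0" and N_dvd_m: "N dvd m"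
    and carrier_eq: "carrier G = (\<Pi>\<^sub>E i\<in>{0..<int N}. {0..<int k}) \<times> {0..<int m}"
    and mult_eq: "f \<in> (\<Pi>\<^sub>E i\<in>{0..<int N}. {0..<int k}) \<Longrightarrow> g \<in> (\<Pi>\<^sub>E i\<in>{0..<int N}. {0..<int k}) \<Longrightarrow>
      i \<in> {0..<int m} \<Longrightarrow> j \<in> {0..<int m} \<Longrightarrow>
      (f, i) \<otimes> (g, j) =
        (\<lambda>t\<in>{0..<int N}. (f t + g ((t - i) mod int N)) mod int k, (i + j) mod int m)"
    and one_eq: "\<one> = (\<lambda>t\<in>{0..<int N}. 0, 0)"
begin

definition configs :: "(int \<Rightarrow> int) set" where
  "configs = (\<Pi>\<^sub>E i\<in>{0..<int N}. {0..<int k})"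

definition dark :: "int \<Rightarrow> int" where
  "dark = (\<lambda>t\<in>{0..<int N}. 0)"

lemma dark_in_configs: "dark \<in> configs"
  using k_pos by (simp add: configs_def dark_def)

lemma carrier_configs: "carrier G = configs \<times> {0..<int m}"
  by (simp add: carrier_eq configs_def)

lemma mult_configs:
  assumes "f \<in> configs" "g \<in> configs" "i \<in> {0..<int m}" "j \<in> {0..<int m}"
  shows "(f, i) \<otimes> (g, j) =
    (\<lambda>t\<in>{0..<int N}. (f t + g ((t - i) mod int N)) mod int k, (i + j) mod int m)"
  using mult_eq assms unfolding configs_def .

lemma one_dark: "\<one> = (dark, 0)"
  by (simp only: one_eq dark_def)

lemma dark_app: "t \<in> {0..<int N} \<Longrightarrow> dark t = 0"
  by (simp add: dark_def)

lemma mult_dark: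
  assumes f: "f \<in> configs" and i: "i \<in> {0..<int m}" and j: "j \<in> {0..<int m}"
  shows "(f, i) \<otimes> (dark, j) = (f, (i + j) mod int m)"
proof -
  have "(\<lambda>t\<in>{0..<int N}. (f t + dark ((t - i) mod int N)) mod int k) = f"
    using f N_pos by (auto simp: configs_def dark_app fun_eq_iff restrict_def PiE_iff extensional_def)
  then show ?thesis
    using mult_configs[OF f dark_in_configs i j] by simp
qed

text \<open>Because \<open>N\<close> divides \<open>m\<close>, a cursor reduced modulo
  \<open>m\<close> still points to the same lamp. This makes the shift by the cursor well
  defined.\<close>

lemma mod_N_mod_m: "(j mod int m) mod int N = j mod int N"
  using N_dvd_m by (simp add: mod_mod_cancel)

lemma mult_in_configs: "(\<lambda>t\<in>{0..<int N}. h t mod int k) \<in> configs"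
  using k_pos by (simp add: configs_def)

lemma is_group: "group G"
proof (rule groupI)
  fix u v assume "u \<in> carrier G" "v \<in> carrier G"
  then show "u \<otimes> v \<in> carrier G"
    using m_pos mult_in_configs by (auto simp: carrier_configs mult_configs)
next
  show "\<one> \<in> carrier G"
    using m_pos dark_in_configs by (simp add: carrier_configs one_dark)
next
  fix u v w assume "u \<in> carrier G" "v \<in> carrier G" "w \<in> carrier G"
  then obtain f g h i j l where eqs: "u = (f, i)" "v = (g, j)" "w = (h, l)"
    and f: "f \<in> configs" "g \<in> configs" "h \<in> configs"
    and i: "i \<in> {0..<int m}" "j \<in> {0..<int m}" "l \<in> {0..<int m}"
    by (auto simp: carrier_configs)
  have m: "x mod int m \<in> {0..<int m}" for x
    using m_pos by simp
  \<comment> \<open>This is the action law, shifting by \<open>i\<close> and by \<open>j\<close>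
    being the shift by their sum, on which associativity rests.\<close>
  have idx: "(t - (i + j) mod int m) mod int N = ((t - i) mod int N - j) mod int N" for t
  proof -
    have "(t - (i + j) mod int m) mod int N = (t - (i + j)) mod int N"
      using mod_diff_right_eq[of t "(i + j) mod int m" "int N"]
        mod_diff_right_eq[of t "i + j" "int N"]
      by (simp only: mod_N_mod_m)
    also have "\<dots> = ((t - i) mod int N - j) mod int N"
      by (simp add: mod_diff_left_eq diff_diff_eq)
    finally show ?thesis .
  qed
  have N: "x mod int N \<in> {0..<int N}" for x
    using N_pos by simp
  show "u \<otimes> v \<otimes> w = u \<otimes> (v \<otimes> w)"
    unfolding eqs mult_configs[OF f(1,2) i(1,2)] mult_configs[OF f(2,3) i(2,3)]
      mult_configs[OF mult_in_configs f(3) m i(3)] mult_configs[OF f(1) mult_in_configs i(1) m]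
  proof (rule arg_cong2[of _ _ _ _ Pair])
    show "(\<lambda>t\<in>{0..<int N}. ((\<lambda>t\<in>{0..<int N}. (f t + g ((t - i) mod int N)) mod int k) t +
          h ((t - (i + j) mod int m) mod int N)) mod int k) =
        (\<lambda>t\<in>{0..<int N}. (f t + (\<lambda>t\<in>{0..<int N}. (g t + h ((t - j) mod int N)) mod int k)
          ((t - i) mod int N)) mod int k)"
      by (rule restrict_ext) (simp only: restrict_apply' N idx mod_add_left_eq mod_add_right_eq add.assoc)
    show "((i + j) mod int m + l) mod int m = (i + (j + l) mod int m) mod int m"
      by (simp only: mod_add_left_eq mod_add_right_eq add.assoc)
  qed
next
  fix u assume "u \<in> carrier G"
  then obtain f i where u: "u = (f, i)" and f: "f \<in> configs" and i: "i \<in> {0..<int m}"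
    by (auto simp: carrier_configs)
  have f_range: "f t \<in> {0..<int k}" if "t \<in> {0..<int N}" for t
    using f that by (auto simp: configs_def)
  have f_ext: "restrict f {0..<int N} = f"
    using f by (simp add: configs_def)
  have zero: "0 \<in> {0..<int m}" and N: "x mod int N \<in> {0..<int N}" for x
    using m_pos N_pos by simp_all
  have "(\<lambda>t\<in>{0..<int N}. (dark t + f ((t - 0) mod int N)) mod int k) = restrict f {0..<int N}"
    using f_range by (intro restrict_ext) (simp add: dark_app)
  then show "\<one> \<otimes> u = u"
    using i unfolding one_dark u mult_configs[OF dark_in_configs f zero i] f_ext by simp
  \<comment> \<open>The left inverse moves the cursor back by \<open>i\<close>, so its product with
    \<open>u\<close> reads \<open>f\<close> at \<open>t + i\<close>; \<open>g\<close> has to cancel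
    that value.\<close>
  define g where "g = (\<lambda>t\<in>{0..<int N}. (- f ((t + i) mod int N)) mod int k)"
  have g: "g \<in> configs" and m: "(- i) mod int m \<in> {0..<int m}"
    using mult_in_configs m_pos by (simp_all add: g_def)
  have idx: "(t - (- i) mod int m) mod int N = (t + i) mod int N" for t
    using mod_diff_right_eq[of t "(- i) mod int m" "int N"] mod_diff_right_eq[of t "- i" "int N"]
    by (simp add: mod_N_mod_m)
  have "(\<lambda>t\<in>{0..<int N}. (g t + f ((t - (- i) mod int m) mod int N)) mod int k) = dark"
    unfolding dark_def idx by (rule restrict_ext) (simp add: g_def mod_add_left_eq)
  moreover have "((- i) mod int m + i) mod int m = 0"
    by (simp add: mod_add_left_eq)
  ultimately have "(g, (- i) mod int m) \<otimes> u = \<one>"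
    unfolding one_dark u mult_configs[OF g f m i] by simp
  moreover have "(g, (- i) mod int m) \<in> carrier G"
    using g m by (simp add: carrier_configs)
  ultimately show "\<exists>v\<in>carrier G. v \<otimes> u = \<one>" by blast
qed

end

sublocale shift_group \<subseteq> group G
  by (rule is_group)

section \<open>The step set given by generators of the two copies\<close>

context shift_group
begin

definition lamp :: "int \<Rightarrow> int \<Rightarrow> int \<Rightarrow> int" where
  "lamp p r = (\<lambda>t\<in>{0..<int N}. if t = p then r else 0)"

lemma lamp_in_configs: "r \<in> {0..<int k} \<Longrightarrow> lamp p r \<in> configs"
  using k_pos by (auto simp: lamp_def configs_def)

lemma lamp_inj: "p \<in> {0..<int N} \<Longrightarrow> lamp p r = lamp p r' \<longleftrightarrow> r = r'"
  by (auto simp: lamp_def dest!: fun_cong[of _ _ p])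

lemma finite_carrier: "finite (carrier G)"
  by (simp add: carrier_eq finite_PiE)

lemma card_carrier: "card (carrier G) = k ^ N * m"
  by (simp add: carrier_eq card_cartesian_product card_PiE)

lemma complement_copy_eq:
  "complement_copy {0..<int N} (integer_mod_group k) (integer_mod_group m) =
    {dark} \<times> {0..<int m}"
  using m_pos by (simp add: complement_copy_def carrier_integer_mod_group dark_def)

lemma coordinate_copy_eq:
  assumes "p \<in> {0..<int N}"
  shows "coordinate_copy {0..<int N} (integer_mod_group k) (integer_mod_group m) p =
    (\<lambda>r. (lamp p r, 0)) ` {0..<int k}"
proof -
  have "{f \<in> configs. \<forall>i\<in>{0..<int N}. i \<noteq> p \<longrightarrow> f i = 0} = lamp p ` {0..<int k}"
  proof (intro equalityI subsetI)
    fix f assume f: "f \<in> {f \<in> configs. \<forall>i\<in>{0..<int N}. i \<noteq> p \<longrightarrow> f i = 0}"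
    then have "f = lamp p (f p)"
      by (auto simp: lamp_def configs_def fun_eq_iff restrict_def PiE_iff extensional_def)
    moreover have "f p \<in> {0..<int k}"
      using f assms by (auto simp: configs_def)
    ultimately show "f \<in> lamp p ` {0..<int k}" by blast
  qed (use lamp_in_configs in \<open>auto simp: lamp_def\<close>)
  then show ?thesis
    using k_pos by (auto simp: coordinate_copy_def carrier_sum_group_finite carrier_integer_mod_group
      configs_def)
qed

lemma pow_complement:
  assumes "\<beta> \<in> {0..<int m}"
  shows "(dark, \<beta>) [^] (n::nat) = (dark, (int n * \<beta>) mod int m)"
proof (induction n)
  case (Suc n)
  then show ?case
    using mult_dark[OF dark_in_configs _ assms, of "(int n * \<beta>) mod int m"] m_pos
    by (simp add: mod_simps algebra_simps)
qed (simp add: one_dark)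

text \<open>As \<open>b\<close> generates the cursor copy, it moves the cursor by some
  \<open>\<beta>\<close> that is invertible modulo \<open>m\<close>. As \<open>c\<close> generates
  the summand at \<open>p\<close>, its powers with exponent below \<open>k\<close> set this lamp to
  every value once. So the step set depends on \<open>b\<close> only through \<open>\<beta>\<close>,
  and on \<open>c\<close> only through the summand.\<close>

lemma switch_walk_eq:
  assumes p: "p \<in> {0..<int N}"
    and b: "generate G {b} =
      complement_copy {0..<int N} (integer_mod_group k) (integer_mod_group m)"
    and c: "generate G {c} =
      coordinate_copy {0..<int N} (integer_mod_group k) (integer_mod_group m) p"
  obtains \<beta> n where "\<beta> \<in> {0..<int m}" "[n * \<beta> = 1] (mod int m)"
    "switch_walk G k c b = (\<lambda>r. (lamp p r, \<beta>)) ` {0..<int k}"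
proof -
  have "b \<in> generate G {b}" "c \<in> generate G {c}"
    by (auto intro: generate.incl)
  then obtain \<beta> where \<beta>: "b = (dark, \<beta>)" "\<beta> \<in> {0..<int m}"
    and bG: "b \<in> carrier G" and cG: "c \<in> carrier G"
    using dark_in_configs lamp_in_configs m_pos
    by (auto simp: b c complement_copy_eq coordinate_copy_eq[OF p] carrier_configs)
  \<comment> \<open>The class of 1 is a multiple of \<open>\<beta>\<close>, and the exponent
    \<open>n\<close> obtained here is the inverse of \<open>\<beta>\<close>.\<close>
  have "(dark, 1 mod int m) \<in> generate G {b}"
    using m_pos by (simp add: b complement_copy_eq)
  then obtain n :: nat where "(dark, 1 mod int m) = b [^] n"
    using generate_pow_on_finite_carrier[OF finite_carrier bG] by auto
  then have n: "[int n * \<beta> = 1] (mod int m)"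
    by (simp add: \<beta>(1) pow_complement[OF \<beta>(2)] cong_def)
  \<comment> \<open>The order of \<open>c\<close> is the size of the subgroup it generates, so the
    exponents below \<open>k\<close> already exhaust that subgroup.\<close>
  have "ord c = card ((\<lambda>r. (lamp p r, 0 :: int)) ` {0..<int k})"
    by (simp add: generate_pow_card[OF cG] c coordinate_copy_eq[OF p])
  also have "\<dots> = k"
    using lamp_inj[OF p] by (subst card_image) (auto simp: inj_on_def)
  finally have "{0..ord c - 1} = {..<k}"
    using k_pos by auto
  then have pows: "generate G {c} = (\<lambda>r. c [^] r) ` {..<k}"
    using generate_pow_on_finite_carrier[OF finite_carrier cG] ord_elems[OF finite_carrier cG]
    by auto
  have "switch_walk G k c b = (\<lambda>h. h \<otimes> b) ` generate G {c}"
    by (simp add: switch_walk_def pows image_image)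
  also have "\<dots> = (\<lambda>r. (lamp p r, 0) \<otimes> b) ` {0..<int k}"
    by (simp add: c coordinate_copy_eq[OF p] image_image)
  also have "\<dots> = (\<lambda>r. (lamp p r, \<beta>)) ` {0..<int k}"
  proof (rule image_cong)
    fix r assume r: "r \<in> {0..<int k}"
    then show "(lamp p r, 0) \<otimes> b = (lamp p r, \<beta>)"
      using mult_dark[OF lamp_in_configs[OF r], of 0 \<beta>] \<beta> m_pos by simp
  qed simp
  finally show ?thesis
    using that[OF \<beta>(2) n] by blast
qed

text \<open>In the Cayley graph a step from a vertex with cursor \<open>\<beta> i\<close> changes the lamp at position
  \<open>p + \<beta> i\<close>, so the \<open>s\<close>-th letter of a word at level \<open>i\<close> is the lamp at \<open>p + \<beta> (i + s)\<close>, the one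
  to be changed \<open>s\<close> steps later. Here \<open>n\<close> is an inverse of \<open>\<beta>\<close> modulo \<open>N\<close>.\<close>

definition lamps :: "int \<Rightarrow> int \<Rightarrow> nat list \<Rightarrow> int \<Rightarrow> int \<Rightarrow> int" where
  "lamps p n x i = (\<lambda>t\<in>{0..<int N}. int (x ! nat ((n * (t - p) - i) mod int N)))"

lemma lamps_in_configs:
  assumes "x \<in> words k N"
  shows "lamps p n x i \<in> configs"
proof -
  have "nat (j mod int N) < length x" for j
    using assms N_pos by (simp add: nat_less_iff)
  then have "x ! nat (j mod int N) < k" for j
    using assms nth_mem by blast
  then show ?thesis by (simp add: lamps_def configs_def)
qed

text \<open>The level enters \<open>lamps\<close> only through an index modulo \<open>N\<close>, so
  it may be reduced modulo any multiple of \<open>N\<close>. This is applied to the moduli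
  \<open>m\<close> and \<open>m * l\<close>.\<close>

lemma lamps_mod: "lamps p n x (i mod int q) = lamps p n x i" if "N dvd q"
proof -
  have "(j - i mod int q) mod int N = (j - i) mod int N" for j
    using that by (metis mod_diff_right_eq mod_mod_cancel of_nat_dvd_iff)
  then show ?thesis by (simp add: lamps_def)
qed

text \<open>At level \<open>i\<close> the first letter sits at the lamp
  \<open>p + \<beta> i\<close>, which is the one the generator changes, from \<open>hd x\<close> to
  \<open>y\<close>. Passing to level \<open>i + 1\<close> lowers every index by one cyclically, so
  this lamp gets the last index, that of the appended letter, and the other letters keep their
  lamps.\<close>

lemma lamps_step:
  assumes p: "p \<in> {0..<int N}" and \<beta>: "\<beta> \<in> {0..<int m}" and n: "[n * \<beta> = 1] (mod int m)"
    and x: "x \<in> words k N" and y: "y < k"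
  shows "(lamps p n (tl (x @ [y])) (i + 1), (\<beta> * (i + 1)) mod int m) =
    (lamps p n x i, (\<beta> * i) mod int m) \<otimes> (lamp p ((int y - int (hd x)) mod int k), \<beta>)"
proof -
  let ?d = "(int y - int (hd x)) mod int k"
  have n': "[n * \<beta> = 1] (mod int N)"
    using n N_dvd_m cong_dvd_modulus by (metis of_nat_dvd_iff)
  \<comment> \<open>The lamp with index 0 is the one touched by the generator: the two conditions
    differ by multiplication with \<open>\<beta>\<close> or its inverse \<open>n\<close> modulo
    \<open>N\<close>.\<close>
  have pos: "(n * (t - p) - i) mod int N = 0 \<longleftrightarrow> (t - (\<beta> * i) mod int m) mod int N = p" for t
  proof -
    have "(t - (\<beta> * i) mod int m) mod int N = (t - \<beta> * i) mod int N"
      using mod_diff_right_eq[of t "(\<beta> * i) mod int m" "int N"]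
        mod_diff_right_eq[of t "\<beta> * i" "int N"]
      by (simp only: mod_N_mod_m)
    moreover have "(t - \<beta> * i) mod int N = p \<longleftrightarrow> [t - p = \<beta> * i] (mod int N)"
    proof -
      have "(t - \<beta> * i) mod int N = p \<longleftrightarrow> [t - \<beta> * i = p] (mod int N)"
        using p by (simp add: cong_def)
      moreover have "t - \<beta> * i - p = t - p - \<beta> * i" by simp
      ultimately show ?thesis by (simp only: cong_iff_dvd_diff)
    qed
    moreover have "[t - p = \<beta> * i] (mod int N) \<longleftrightarrow> [n * (t - p) = i] (mod int N)"
    proof
      assume "[t - p = \<beta> * i] (mod int N)"
      then have "[n * (t - p) = (n * \<beta>) * i] (mod int N)"
        by (metis cong_scalar_left mult.assoc)
      also have "[(n * \<beta>) * i = 1 * i] (mod int N)"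
        using n' by (rule cong_scalar_right)
      finally show "[n * (t - p) = i] (mod int N)" by simp
    next
      assume "[n * (t - p) = i] (mod int N)"
      then have "[\<beta> * i = (n * \<beta>) * (t - p)] (mod int N)"
        by (metis cong_scalar_left cong_sym mult.assoc mult.commute)
      also have "[(n * \<beta>) * (t - p) = 1 * (t - p)] (mod int N)"
        using n' by (rule cong_scalar_right)
      finally have "[\<beta> * i = t - p] (mod int N)" by simp
      then show "[t - p = \<beta> * i] (mod int N)" by (rule cong_sym)
    qed
    moreover have "[n * (t - p) = i] (mod int N) \<longleftrightarrow> (n * (t - p) - i) mod int N = 0"
      by (simp only: cong_iff_dvd_diff dvd_eq_mod_eq_0)
    ultimately show ?thesis by simp
  qed
  \<comment> \<open>For \<open>j = n * (t - p) - i\<close> this compares the value of lamp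
    \<open>t\<close> after the step, at index \<open>j - 1\<close> of the new word, with its value
    before, at index \<open>j\<close> of the old one.\<close>
  have coord: "int (tl (x @ [y]) ! nat ((j - 1) mod int N)) =
      (int (x ! nat (j mod int N)) + (if j mod int N = 0 then ?d else 0)) mod int k" for j
  proof -
    obtain s where s: "j mod int N = int s" "s < N"
    proof
      show "j mod int N = int (nat (j mod int N))" "nat (j mod int N) < N"
        using N_pos by (simp_all add: nat_less_iff)
    qed
    have len: "length x = N" and xs: "x ! s < k"
      using x s nth_mem[of s x] by (auto simp: subset_iff)
    have *: "(j - 1) mod int N = (int s - 1) mod int N"
      using s by (metis mod_diff_left_eq)
    show ?thesis
    proof (cases s)
      case 0
      \<comment> \<open>Index -1 wraps around to \<open>N - 1\<close>, the place of the appended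
        letter.\<close>
      have "(int 0 - 1) mod int N = int (N - 1)"
        using zmod_minus1[of "int N"] N_pos by (auto simp: int_ops(6))
      moreover have "tl (x @ [y]) ! (N - 1) = y" "hd x = x ! 0"
        using len N_pos by (cases x; auto simp: nth_append)+
      moreover have "j mod int N = 0" using s(1) 0 by simp
      ultimately show ?thesis
        using * 0 y by (simp add: mod_add_right_eq)
    next
      case (Suc u)
      then have "(int s - 1) mod int N = int u"
        using s by simp
      moreover have "tl (x @ [y]) ! u = x ! s"
        using len s Suc by (cases x) (auto simp: nth_append)
      ultimately have "int (tl (x @ [y]) ! nat ((j - 1) mod int N)) = int (x ! s)"
        using * by simp
      moreover have "nat (j mod int N) = s" "j mod int N \<noteq> 0"
        using s(1) Suc by simp_all
      ultimately show ?thesis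
        using xs by simp
    qed
  qed
  have d: "?d \<in> {0..<int k}"
    using k_pos by simp
  have "lamps p n (tl (x @ [y])) (i + 1) t =
      (lamps p n x i t + lamp p ?d ((t - (\<beta> * i) mod int m) mod int N)) mod int k"
    if "t \<in> {0..<int N}" for t
    using that coord[of "n * (t - p) - i"] N_pos
    by (simp add: lamps_def lamp_def pos diff_diff_eq)
  moreover have restrict: "lamps p n z j = restrict (lamps p n z j) {0..<int N}" for z j
    by (simp add: lamps_def)
  ultimately have L: "lamps p n (tl (x @ [y])) (i + 1) = (\<lambda>t\<in>{0..<int N}.
      (lamps p n x i t + lamp p ?d ((t - (\<beta> * i) mod int m) mod int N)) mod int k)"
    by (subst restrict) (rule restrict_ext)
  have cursor: "((\<beta> * i) mod int m + \<beta>) mod int m = (\<beta> * (i + 1)) mod int m"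
    by (simp add: mod_add_left_eq distrib_left)
  have "(\<beta> * i) mod int m \<in> {0..<int m}"
    using m_pos by simp
  from mult_configs[OF lamps_in_configs[OF x] lamp_in_configs[OF d] this \<beta>] show ?thesis
    unfolding L cursor by (rule sym)
qed

text \<open>Multiplying the cursor by \<open>n\<close> recovers the level modulo \<open>m\<close>.
  Once the level is known, every letter can be read off from its lamp.\<close>

lemma lamps_inj:
  assumes p: "p \<in> {0..<int N}" and n: "[n * \<beta> = 1] (mod int m)"
    and x: "x \<in> words k N" and x': "x' \<in> words k N"
    and eq: "(lamps p n x i, (\<beta> * i) mod int m) = (lamps p n x' i', (\<beta> * i') mod int m)"
  shows "x = x'" "[i = i'] (mod int m)"
proof -
  have "[n * (\<beta> * i) = n * (\<beta> * i')] (mod int m)"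
    using eq by (auto simp: cong_def intro: cong_scalar_left[unfolded cong_def])
  moreover have "[n * (\<beta> * j) = j] (mod int m)" for j
    using cong_scalar_right[OF n, of j] by (simp add: mult.assoc)
  ultimately show i: "[i = i'] (mod int m)"
    by (meson cong_sym cong_trans)
  then have "i mod int m = i' mod int m" by (simp add: cong_def)
  \<comment> \<open>Since congruent levels give the same placement of letters, both configurations
    can be read at level \<open>i\<close>.\<close>
  then have lamps: "lamps p n x i = lamps p n x' i"
    using eq lamps_mod[OF N_dvd_m] by (metis prod.inject)
  have n': "[n * \<beta> = 1] (mod int N)"
    using n N_dvd_m cong_dvd_modulus by (metis of_nat_dvd_iff)
  show "x = x'"
  proof (rule nth_equalityI)
    fix s assume "s < length x"
    then have s: "s < N" using x by simp
    \<comment> \<open>This is the lamp that carries the letter with index \<open>s\<close> at level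
      \<open>i\<close>.\<close>
    define t where "t = (p + \<beta> * (i + int s)) mod int N"
    have "[n * (t - p) = n * (p + \<beta> * (i + int s) - p)] (mod int N)"
      unfolding t_def by (intro cong_scalar_left cong_diff) (simp_all add: cong_def)
    also have "n * (p + \<beta> * (i + int s) - p) = (n * \<beta>) * (i + int s)"
      by simp
    also have "[(n * \<beta>) * (i + int s) = 1 * (i + int s)] (mod int N)"
      using n' by (rule cong_scalar_right)
    finally have "[n * (t - p) - i = 1 * (i + int s) - i] (mod int N)"
      by (intro cong_diff) simp_all
    then have "(n * (t - p) - i) mod int N = int s"
      using s by (simp add: cong_def)
    moreover have "t \<in> {0..<int N}"
      using N_pos by (simp add: t_def)
    ultimately show "x ! s = x' ! s"
      using fun_cong[OF lamps, of t] by (simp add: lamps_def)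
  qed (use x x' in simp)
qed

section \<open>Isomorphisms between spider-web graphs and Cayley graphs of shift groups\<close>

lemma bij_betw_letters:
  assumes "p \<in> {0..<int N}"
  shows "bij_betw (\<lambda>y. (lamp p ((int y - a) mod int k), \<beta>)) {..<k}
    ((\<lambda>r. (lamp p r, \<beta>)) ` {0..<int k})"
proof -
  have "bij_betw (\<lambda>r. (lamp p r, \<beta>)) {0..<int k} ((\<lambda>r. (lamp p r, \<beta>)) ` {0..<int k})"
    using lamp_inj[OF assms] by (auto simp: bij_betw_def inj_on_def)
  from bij_betw_trans[OF bij_betw_diff_mod[OF k_pos] this] show ?thesis
    by (simp add: comp_def)
qed

lemma steps_in_carrier:
  "\<beta> \<in> {0..<int m} \<Longrightarrow> (\<lambda>r. (lamp p r, \<beta>)) ` {0..<int k} \<subseteq> carrier G"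
  using lamp_in_configs by (auto simp: carrier_configs)

text \<open>The vertex \<open>(x, i)\<close> goes to the configuration that stores \<open>x\<close>
  in visiting order, with cursor \<open>\<beta> i\<close>. The position \<open>p\<close> of the
  switched lamp is arbitrary because \<open>lamps\<close> measures positions relative to it.\<close>

lemma spider_web_shift:
  assumes p: "p \<in> {0..<int N}"
    and b: "generate G {b} =
      complement_copy {0..<int N} (integer_mod_group k) (integer_mod_group m)"
    and c: "generate G {c} =
      coordinate_copy {0..<int N} (integer_mod_group k) (integer_mod_group m) p"
  shows "generate G (switch_walk G k c b) = carrier G \<and>
    digraph_iso (spider_web k N (enat m)) (cayley G (switch_walk G k c b))"
proof -
  obtain \<beta> n where \<beta>: "\<beta> \<in> {0..<int m}" and n: "[n * \<beta> = 1] (mod int m)"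
    and S: "switch_walk G k c b = (\<lambda>r. (lamp p r, \<beta>)) ` {0..<int k}"
    using switch_walk_eq[OF assms] .
  let ?\<Phi> = "\<lambda>x i. (lamps p n x i, (\<beta> * i) mod int m)"
  have car: "carrier (cyc (enat m)) = {0..<int m}"
    using m_pos by (simp add: cyc_def carrier_integer_mod_group)
  show ?thesis
    unfolding S
  proof (rule spider_web_cayley[where \<Phi> = ?\<Phi>
        and \<rho> = "\<lambda>x y. (lamp p ((int y - int (hd x)) mod int k), \<beta>)"])
    show "bij_betw (\<lambda>(x, i). ?\<Phi> x i) (words k N \<times> carrier (cyc (enat m))) (carrier G)"
    proof (rule bij_betw_imageI)
      show inj: "inj_on (\<lambda>(x, i). ?\<Phi> x i) (words k N \<times> carrier (cyc (enat m)))"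
      proof (rule inj_on_case_prodI)
        fix x i x' i'
        assume "x \<in> words k N" "i \<in> carrier (cyc (enat m))"
          "x' \<in> words k N" "i' \<in> carrier (cyc (enat m))" "?\<Phi> x i = ?\<Phi> x' i'"
        then show "x = x' \<and> i = i'"
          using lamps_inj[OF p n, of x x' i i'] by (auto simp: cong_def car)
      qed
      \<comment> \<open>Surjectivity is a count: both sides have \<open>k ^ N * m\<close> elements,
        and the map is injective.\<close>
      have "(\<lambda>(x, i). ?\<Phi> x i) ` (words k N \<times> carrier (cyc (enat m))) \<subseteq> carrier G"
        using lamps_in_configs m_pos by (auto simp: carrier_configs)
      then show "(\<lambda>(x, i). ?\<Phi> x i) ` (words k N \<times> carrier (cyc (enat m))) = carrier G"
        using card_image[OF inj]
        by (intro card_subset_eq finite_carrier)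
          (simp_all add: card_cartesian_product car card_words card_carrier)
    qed
    fix x i y assume x: "x \<in> words k N" and "y < k"
    then show "?\<Phi> (tl (x @ [y])) (i \<otimes>\<^bsub>cyc (enat m)\<^esub> cyc_one (enat m)) =
        ?\<Phi> x i \<otimes> (lamp p ((int y - int (hd x)) mod int k), \<beta>)"
      using lamps_step[OF p \<beta> n x, of y i]
      by (simp add: mult_cyc cyc_one_eq lamps_mod[OF N_dvd_m] mod_simps)
  qed (use group_axioms steps_in_carrier[OF \<beta>] k_pos bij_betw_letters[OF p] in auto)
qed

text \<open>By the Chinese remainder theorem a level modulo \<open>m * l\<close> amounts to its
  residues modulo \<open>m\<close> and modulo \<open>l\<close>. The cursor records the first,
  multiplied by the unit \<open>\<beta>\<close>, and the cyclic factor records the second and grows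
  by 1 at each step.\<close>

lemma spider_web_shift_times_cyclic:
  assumes l: "l > 0" "coprime m l" and p: "p \<in> {0..<int N}"
    and b: "generate G {b} =
      complement_copy {0..<int N} (integer_mod_group k) (integer_mod_group m)"
    and c: "generate G {c} =
      coordinate_copy {0..<int N} (integer_mod_group k) (integer_mod_group m) p"
  shows "generate (G \<times>\<times> integer_mod_group l) (switch_walk G k c b \<times> {cyc_one (enat l)}) =
      carrier (G \<times>\<times> integer_mod_group l) \<and>
    digraph_iso (spider_web k N (enat (m * l)))
      (cayley (G \<times>\<times> integer_mod_group l) (switch_walk G k c b \<times> {cyc_one (enat l)}))"
proof -
  obtain \<beta> n where \<beta>: "\<beta> \<in> {0..<int m}" and n: "[n * \<beta> = 1] (mod int m)"
    and S: "switch_walk G k c b = (\<lambda>r. (lamp p r, \<beta>)) ` {0..<int k}"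
    using switch_walk_eq[OF p b c] .
  let ?H = "G \<times>\<times> integer_mod_group l"
  let ?M = "enat (m * l)"
  let ?\<Phi> = "\<lambda>x i. ((lamps p n x i, (\<beta> * i) mod int m), i mod int l)"
  have car: "carrier (cyc ?M) = {0..<int (m * l)}"
    using m_pos l by (simp add: cyc_def carrier_integer_mod_group)
  have carH: "carrier ?H = carrier G \<times> {0..<int l}"
    using l by (simp add: carrier_integer_mod_group)
  show ?thesis
    unfolding S
  proof (rule spider_web_cayley[where \<Phi> = ?\<Phi> and
        \<rho> = "\<lambda>x y. ((lamp p ((int y - int (hd x)) mod int k), \<beta>), cyc_one (enat l))"])
    show "bij_betw (\<lambda>(x, i). ?\<Phi> x i) (words k N \<times> carrier (cyc ?M)) (carrier ?H)"
    proof (rule bij_betw_imageI)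
      show inj: "inj_on (\<lambda>(x, i). ?\<Phi> x i) (words k N \<times> carrier (cyc ?M))"
      proof (rule inj_on_case_prodI)
        fix x i x' i'
        assume x: "x \<in> words k N" "x' \<in> words k N"
          and i: "i \<in> carrier (cyc ?M)" "i' \<in> carrier (cyc ?M)" and eq: "?\<Phi> x i = ?\<Phi> x' i'"
        then have "x = x'" "[i = i'] (mod int m)"
          using lamps_inj[OF p n, of x x' i i'] by auto
        \<comment> \<open>The congruence modulo \<open>l\<close> is the equality of the cyclic
          components; coprimality combines it with the one modulo \<open>m\<close>.\<close>
        moreover from this have "[i = i'] (mod int m * int l)"
          using eq l by (intro coprime_cong_mult) (auto simp: cong_def)
        ultimately show "x = x' \<and> i = i'"
          using i by (auto simp: cong_def car)
      qed
      have "(\<lambda>(x, i). ?\<Phi> x i) ` (words k N \<times> carrier (cyc ?M)) \<subseteq> carrier ?H"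
        using lamps_in_configs m_pos l unfolding carH by (auto simp: carrier_configs)
      then show "(\<lambda>(x, i). ?\<Phi> x i) ` (words k N \<times> carrier (cyc ?M)) = carrier ?H"
        using card_image[OF inj]
        by (intro card_subset_eq) (simp_all only: carH car finite_carrier card_cartesian_product
            card_words card_carrier finite_cartesian_product finite_atLeastLessThan_int
            card_atLeastLessThan_int diff_zero nat_int mult.assoc)
    qed
    fix x y assume x: "x \<in> words k N"
    show "bij_betw (\<lambda>y. ((lamp p ((int y - int (hd x)) mod int k), \<beta>), cyc_one (enat l))) {..<k}
        ((\<lambda>r. (lamp p r, \<beta>)) ` {0..<int k} \<times> {cyc_one (enat l)})"
    proof -
      have "bij_betw (\<lambda>s. (s, cyc_one (enat l))) A (A \<times> {cyc_one (enat l)})" for A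
        by (auto simp: bij_betw_def inj_on_def)
      from bij_betw_trans[OF bij_betw_letters[OF p] this] show ?thesis
        by (simp add: comp_def)
    qed
    fix i assume y: "y < k"
    \<comment> \<open>The level wraps around at \<open>m * l\<close>, and none of the components of
      the image notices this.\<close>
    have "(j mod int (m * l)) mod int l = j mod int l" "(j mod int (m * l)) mod int m = j mod int m" for j
      by (simp_all add: mod_mod_cancel)
    moreover from this have "(\<beta> * (j mod int (m * l))) mod int m = (\<beta> * j) mod int m" for j
      by (metis mod_mult_right_eq)
    moreover have "lamps p n z (j mod int (m * l)) = lamps p n z j" for z j
      using N_dvd_m by (intro lamps_mod) simp
    ultimately show "?\<Phi> (tl (x @ [y])) (i \<otimes>\<^bsub>cyc ?M\<^esub> cyc_one ?M) =
        ?\<Phi> x i \<otimes>\<^bsub>?H\<^esub> ((lamp p ((int y - int (hd x)) mod int k), \<beta>), cyc_one (enat l))"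
      using lamps_step[OF p \<beta> n x y, of i]
      by (simp add: mult_cyc cyc_one_eq mod_add_right_eq mod_add_left_eq del: of_nat_mult)
  next
    show "group ?H"
      using group_axioms by (simp add: DirProd_group)
    show "(\<lambda>r. (lamp p r, \<beta>)) ` {0..<int k} \<times> {cyc_one (enat l)} \<subseteq> carrier ?H"
      using steps_in_carrier[OF \<beta>] l unfolding carH by (auto simp: cyc_one_def)
  qed (use k_pos in auto)
qed

end

section \<open>The groups of the theorem\<close>

lemma shift_group_shift_extension:
  assumes "k > 0" "N > 0" "l > 0"
  shows "shift_group (shift_extension k N (N * l)) k N (N * l)"
proof
  show "carrier (shift_extension k N (N * l)) =
      (\<Pi>\<^sub>E i\<in>{0..<int N}. {0..<int k}) \<times> {0..<int (N * l)}"
    using assms by (simp add: shift_extension_def semidirect_def carrier_sum_group_finite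
        carrier_integer_mod_group)
  show "(f, i) \<otimes>\<^bsub>shift_extension k N (N * l)\<^esub> (g, j) =
      (\<lambda>t\<in>{0..<int N}. (f t + g ((t - i) mod int N)) mod int k, (i + j) mod int (N * l))" for f g i j
    by (auto simp: shift_extension_def semidirect_def intro!: restrict_ext)
  show "\<one>\<^bsub>shift_extension k N (N * l)\<^esub> = (\<lambda>t\<in>{0..<int N}. 0, 0)"
    by (simp add: shift_extension_def semidirect_def)
qed (use assms in auto)

text \<open>The regular action in the wreath product evaluates a configuration at
  \<open>inv x \<otimes> i\<close>, which in the cyclic group is \<open>(i - x) mod N\<close>. This
  is the cyclic shift, with \<open>m = N\<close>.\<close>

lemma shift_group_lamplighter:
  assumes "k > 0" "N > 0"
  shows "shift_group (lamplighter k N) k N N"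
proof
  have N: "carrier (integer_mod_group N) = {0..<int N}"
    using assms by (simp add: carrier_integer_mod_group)
  show "carrier (lamplighter k N) = (\<Pi>\<^sub>E i\<in>{0..<int N}. {0..<int k}) \<times> {0..<int N}"
    using assms by (simp add: lamplighter_def wreath_def semidirect_def carrier_sum_group_finite
        carrier_integer_mod_group)
  show "(f, i) \<otimes>\<^bsub>lamplighter k N\<^esub> (g, j) =
      (\<lambda>t\<in>{0..<int N}. (f t + g ((t - i) mod int N)) mod int k, (i + j) mod int N)"
    if "i \<in> {0..<int N}" for f g i j
  proof -
    have "inv\<^bsub>integer_mod_group N\<^esub> i = (- i) mod int N"
      using that N by (intro inv_integer_mod_group) simp
    moreover have "((- i) mod int N + t) mod int N = (t - i) mod int N" for t
      by (simp add: mod_add_left_eq)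
    ultimately show ?thesis
      by (auto simp: lamplighter_def wreath_def semidirect_def N intro!: restrict_ext)
  qed
  show "\<one>\<^bsub>lamplighter k N\<^esub> = (\<lambda>t\<in>{0..<int N}. 0, 0)"
    by (simp add: lamplighter_def wreath_def semidirect_def N)
qed (use assms in auto)

text \<open>Every choice of generators \<open>b\<close> and \<open>c\<close> of the two copies is
  allowed. The definition \<open>cayley\<close> accepts any set, so each case also asserts that the
  steps generate the group.\<close>

theorem theorem6p8:
  fixes k N l :: nat
  assumes "k \<ge> 2" and "N \<ge> 1" and "l \<ge> 1"
  shows
    "(\<forall>p\<in>{0..<int N}. \<forall>b c.
        generate (shift_extension k N (N * l)) {b}
          = complement_copy {0..<int N} (integer_mod_group k) (integer_mod_group (N * l)) \<and>
        generate (shift_extension k N (N * l)) {c}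
          = coordinate_copy {0..<int N} (integer_mod_group k) (integer_mod_group (N * l)) p \<longrightarrow>
        generate (shift_extension k N (N * l)) (switch_walk (shift_extension k N (N * l)) k c b)
          = carrier (shift_extension k N (N * l)) \<and>
        digraph_iso (spider_web k N (enat (N * l)))
          (cayley (shift_extension k N (N * l)) (switch_walk (shift_extension k N (N * l)) k c b)))
   \<and>
     (coprime N l \<longrightarrow> (\<forall>b c.
        generate (lamplighter k N) {b}
          = complement_copy (carrier (integer_mod_group N)) (integer_mod_group k) (integer_mod_group N) \<and>
        generate (lamplighter k N) {c}
          = coordinate_copy (carrier (integer_mod_group N)) (integer_mod_group k) (integer_mod_group N) 0 \<longrightarrow>
        generate (lamplighter k N \<times>\<times> integer_mod_group l)
            (switch_walk (lamplighter k N) k c b \<times> {cyc_one (enat l)})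
          = carrier (lamplighter k N \<times>\<times> integer_mod_group l) \<and>
        multigraph_iso (underlying (spider_web k N (enat (N * l))))
          (underlying (cayley (lamplighter k N \<times>\<times> integer_mod_group l)
             (switch_walk (lamplighter k N) k c b \<times> {cyc_one (enat l)})))))
   \<and>
     (\<forall>M\<ge>1. \<forall>b c.
        generate (lamplighter k M) {b}
          = complement_copy (carrier (integer_mod_group M)) (integer_mod_group k) (integer_mod_group M) \<and>
        generate (lamplighter k M) {c}
          = coordinate_copy (carrier (integer_mod_group M)) (integer_mod_group k) (integer_mod_group M) 0 \<longrightarrow>
        generate (lamplighter k M) (switch_walk (lamplighter k M) k c b) = carrier (lamplighter k M) \<and>
        multigraph_iso (underlying (spider_web k M (enat M)))
          (underlying (cayley (lamplighter k M) (switch_walk (lamplighter k M) k c b))))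
   \<and>
     (\<forall>M\<ge>1.
        generate (integer_mod_group k \<times>\<times> integer_mod_group M) ({0..<int k} \<times> {cyc_one (enat M)})
          = carrier (integer_mod_group k \<times>\<times> integer_mod_group M) \<and>
        multigraph_iso (underlying (spider_web k 1 (enat M)))
          (underlying (cayley (integer_mod_group k \<times>\<times> integer_mod_group M)
             ({0..<int k} \<times> {cyc_one (enat M)}))))
   \<and>
     (generate (integer_mod_group k \<times>\<times> integer_group) ({0..<int k} \<times> {1})
          = carrier (integer_mod_group k \<times>\<times> integer_group) \<and>
      multigraph_iso (underlying (spider_web k 1 \<infinity>))
        (underlying (cayley (integer_mod_group k \<times>\<times> integer_group) ({0..<int k} \<times> {1}))))"
proof (intro conjI ballI allI impI; (elim conjE)?)
  have pos: "k > 0" "N > 0" "l > 0"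
    using assms by simp_all
  have carrier_mod: "carrier (integer_mod_group n) = {0..<int n}" if "n \<ge> 1" for n
    using that by (simp add: carrier_integer_mod_group)
  {
    fix p b c
    let ?G = "shift_extension k N (N * l)"
    assume "p \<in> {0..<int N}"
      and "generate ?G {b} = complement_copy {0..<int N} (integer_mod_group k) (integer_mod_group (N * l))"
      and "generate ?G {c} = coordinate_copy {0..<int N} (integer_mod_group k) (integer_mod_group (N * l)) p"
    note * = shift_group.spider_web_shift[OF shift_group_shift_extension[OF pos] this]
    show "generate ?G (switch_walk ?G k c b) = carrier ?G"
      and "digraph_iso (spider_web k N (enat (N * l))) (cayley ?G (switch_walk ?G k c b))"
      using * by blast+
  next
    fix b c
    let ?G = "lamplighter k N" and ?C = "integer_mod_group l"
    assume "coprime N l"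
      and b: "generate ?G {b} =
        complement_copy (carrier (integer_mod_group N)) (integer_mod_group k) (integer_mod_group N)"
      and c: "generate ?G {c} =
        coordinate_copy (carrier (integer_mod_group N)) (integer_mod_group k) (integer_mod_group N) 0"
    \<comment> \<open>For the lamplighter group the cursor modulus is \<open>N\<close>, so the
      coprimality required for the product is that of \<open>N\<close> and \<open>l\<close>.\<close>
    then have *: "generate (?G \<times>\<times> ?C) (switch_walk ?G k c b \<times> {cyc_one (enat l)}) =
        carrier (?G \<times>\<times> ?C) \<and>
      digraph_iso (spider_web k N (enat (N * l)))
        (cayley (?G \<times>\<times> ?C) (switch_walk ?G k c b \<times> {cyc_one (enat l)}))"
      using pos assms(2)
      by (intro shift_group.spider_web_shift_times_cyclic[where p = 0] shift_group_lamplighter)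
        (simp_all only: carrier_mod, simp_all)
    show "generate (?G \<times>\<times> ?C) (switch_walk ?G k c b \<times> {cyc_one (enat l)}) =
        carrier (?G \<times>\<times> ?C)"
      and "multigraph_iso (underlying (spider_web k N (enat (N * l))))
        (underlying (cayley (?G \<times>\<times> ?C) (switch_walk ?G k c b \<times> {cyc_one (enat l)})))"
      using * digraph_iso_imp_multigraph_iso by blast+
  next
    fix M :: nat and b c
    let ?G = "lamplighter k M"
    assume "M \<ge> 1"
      and "generate ?G {b} =
        complement_copy (carrier (integer_mod_group M)) (integer_mod_group k) (integer_mod_group M)"
      and "generate ?G {c} =
        coordinate_copy (carrier (integer_mod_group M)) (integer_mod_group k) (integer_mod_group M) 0"
    then have *: "generate ?G (switch_walk ?G k c b) = carrier ?G \<and>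
      digraph_iso (spider_web k M (enat M)) (cayley ?G (switch_walk ?G k c b))"
      using pos(1)
      by (intro shift_group.spider_web_shift[where p = 0] shift_group_lamplighter)
        (simp_all only: carrier_mod, simp_all)
    show "generate ?G (switch_walk ?G k c b) = carrier ?G"
      and "multigraph_iso (underlying (spider_web k M (enat M)))
        (underlying (cayley ?G (switch_walk ?G k c b)))"
      using * digraph_iso_imp_multigraph_iso by blast+
  next
    fix M :: nat
    let ?G = "integer_mod_group k \<times>\<times> integer_mod_group M"
    show "generate ?G ({0..<int k} \<times> {cyc_one (enat M)}) = carrier ?G"
      and "multigraph_iso (underlying (spider_web k 1 (enat M)))
        (underlying (cayley ?G ({0..<int k} \<times> {cyc_one (enat M)})))"
      using spider_web_length_one[OF pos(1), of "enat M"] digraph_iso_imp_multigraph_iso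
      by (auto simp: cyc_def)
  next
    let ?G = "integer_mod_group k \<times>\<times> integer_group"
    show "generate ?G ({0..<int k} \<times> {1}) = carrier ?G"
      and "multigraph_iso (underlying (spider_web k 1 \<infinity>))
        (underlying (cayley ?G ({0..<int k} \<times> {1})))"
      using spider_web_length_one[OF pos(1), of "\<infinity>"] digraph_iso_imp_multigraph_iso
      by (auto simp: cyc_def cyc_one_def)
  }
qed

end
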